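(* The TS problem is solvable in time $O(|V|+|E|)$ when the input graph $G=(V,E)$ is $P_4$-free. Moreover, a shortest reconfiguration sequence between the two given independent sets, if one exists, can be found in time $O(|V|+|E|)$.
   Context: TS problem: given a graph $G$ and two independent sets $A,B$ of $G$ (viewed as token sets), decide whether $A$ can be transformed into $B$ by a sequence of independent sets, each obtained from the previous one by sliding a single token along an edge of $G$ to an unoccupied neighboring vertex. A graph is $P_4$-free if it has no induced subgraph isomorphic to the path on four vertices. *)

theory Defs
  imports Main
begin

section \<open>Finite simple graphs\<close>

type_synonym 'a ugraph = "'a set \<times> 'a set set"

abbreviation verts :: "'a ugraph \<Rightarrow> 'a set" where "verts \<equiv> fst"
abbreviation edges :: "'a ugraph \<Rightarrow> 'a set set" where "edges \<equiv> snd"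

definition simple_graph :: "'a ugraph \<Rightarrow> bool" where
  "simple_graph G \<longleftrightarrow>
     finite (verts G) \<and> (\<forall>e\<in>edges G. \<exists>u\<in>verts G. \<exists>v\<in>verts G. u \<noteq> v \<and> e = {u, v})"

definition induced_subgraph :: "'a ugraph \<Rightarrow> 'a set \<Rightarrow> 'a ugraph" where
  "induced_subgraph G S = (S, {e \<in> edges G. e \<subseteq> S})"

definition graph_iso :: "'a ugraph \<Rightarrow> 'b ugraph \<Rightarrow> bool" where
  "graph_iso G H \<longleftrightarrow>
     (\<exists>f. bij_betw f (verts G) (verts H) \<and>
          (\<forall>u\<in>verts G. \<forall>v\<in>verts G. {u, v} \<in> edges G \<longleftrightarrow> {f u, f v} \<in> edges H))"

definition path_graph :: "nat \<Rightarrow> nat ugraph" where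
  "path_graph k = ({..<k}, {{i, Suc i} | i. Suc i < k})"

definition P4_free :: "'a ugraph \<Rightarrow> bool" where
  "P4_free G \<longleftrightarrow> \<not> (\<exists>S\<subseteq>verts G. graph_iso (induced_subgraph G S) (path_graph 4))"


section \<open>Token sliding\<close>

definition independent_set :: "'a ugraph \<Rightarrow> 'a set \<Rightarrow> bool" where
  "independent_set G S \<longleftrightarrow> S \<subseteq> verts G \<and> (\<forall>u\<in>S. \<forall>v\<in>S. {u, v} \<notin> edges G)"

definition slide :: "'a ugraph \<Rightarrow> 'a set \<Rightarrow> 'a set \<Rightarrow> bool" where
  "slide G S S' \<longleftrightarrow>
     (\<exists>u v. u \<in> S \<and> v \<notin> S \<and> {u, v} \<in> edges G \<and> S' = insert v (S - {u}))"

definition reconf_seq :: "'a ugraph \<Rightarrow> 'a set \<Rightarrow> 'a set \<Rightarrow> 'a set list \<Rightarrow> bool" where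
  "reconf_seq G A B Ss \<longleftrightarrow>
     Ss \<noteq> [] \<and> hd Ss = A \<and> last Ss = B \<and>
     (\<forall>S\<in>set Ss. independent_set G S) \<and> successively (slide G) Ss"

definition reconfigurable :: "'a ugraph \<Rightarrow> 'a set \<Rightarrow> 'a set \<Rightarrow> bool" where
  "reconfigurable G A B \<longleftrightarrow> (\<exists>Ss. reconf_seq G A B Ss)"

definition shortest_reconf_seq :: "'a ugraph \<Rightarrow> 'a set \<Rightarrow> 'a set \<Rightarrow> 'a set list \<Rightarrow> bool" where
  "shortest_reconf_seq G A B Ss \<longleftrightarrow>
     reconf_seq G A B Ss \<and> (\<forall>Ss'. reconf_seq G A B Ss' \<longrightarrow> length Ss \<le> length Ss')"

text \<open>
  The sets of a sequence may have total size quadratic in the size of the graph, even when the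
  number of slides is linear.  A sequence starting in \<open>A\<close> is therefore output as the list of its
  slides (source, target), and \<open>token_sets\<close> recovers the sets.
\<close>

fun token_sets :: "'a set \<Rightarrow> ('a \<times> 'a) list \<Rightarrow> 'a set list" where
  "token_sets A [] = [A]"
| "token_sets A ((u, v) # ms) = A # token_sets (insert v (A - {u})) ms"


section \<open>Random access machine\<close>

text \<open>
  A unit-cost random access machine with structured control flow.  Registers and arrays are named
  by numbers occurring literally in the program, so each program uses finitely many of them (which
  a single memory can hold interleaved); only array indices are computed at run time.  Subtraction
  is truncated at 0.
\<close>

record store =
  regs :: "nat \<Rightarrow> nat"
  arrs :: "nat \<Rightarrow> nat \<Rightarrow> nat"

datatype test = Less nat nat | Equal nat nat

datatype com =
    Skip
  | Const nat nat
  | Move nat nat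
  | Add nat nat nat
  | Sub nat nat nat
  | Load nat nat nat    \<comment> \<open>\<open>Load x a i\<close> is \<open>x := a[i]\<close>\<close>
  | Store nat nat nat   \<comment> \<open>\<open>Store a i x\<close> is \<open>a[i] := x\<close>\<close>
  | Seq com com
  | Cond test com com
  | While test com

fun holds :: "test \<Rightarrow> store \<Rightarrow> bool" where
  "holds (Less x y) s \<longleftrightarrow> regs s x < regs s y"
| "holds (Equal x y) s \<longleftrightarrow> regs s x = regs s y"

definition set_reg :: "nat \<Rightarrow> nat \<Rightarrow> store \<Rightarrow> store" where
  "set_reg x w s = s\<lparr>regs := (regs s)(x := w)\<rparr>"

definition set_arr :: "nat \<Rightarrow> nat \<Rightarrow> nat \<Rightarrow> store \<Rightarrow> store" where
  "set_arr a i w s = s\<lparr>arrs := (arrs s)(a := (arrs s a)(i := w))\<rparr>"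

text \<open>
  \<open>exec W c s T s'\<close>: started in \<open>s\<close>, the program \<open>c\<close> halts in \<open>s'\<close> after \<open>T\<close> steps, where
  every instruction and every evaluation of a test is one step.  Machine words hold the numbers
  below \<open>W\<close>; a computation that produces a larger number is stuck and so does not halt.
\<close>

inductive exec :: "nat \<Rightarrow> com \<Rightarrow> store \<Rightarrow> nat \<Rightarrow> store \<Rightarrow> bool" for W :: nat where
  Skip: "exec W Skip s 1 s"
| Const: "k < W \<Longrightarrow> exec W (Const x k) s 1 (set_reg x k s)"
| Move: "exec W (Move x y) s 1 (set_reg x (regs s y) s)"
| Add: "regs s y + regs s z < W \<Longrightarrow> exec W (Add x y z) s 1 (set_reg x (regs s y + regs s z) s)"
| Sub: "exec W (Sub x y z) s 1 (set_reg x (regs s y - regs s z) s)"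
| Load: "exec W (Load x a i) s 1 (set_reg x (arrs s a (regs s i)) s)"
| Store: "exec W (Store a i x) s 1 (set_arr a (regs s i) (regs s x) s)"
| Seq: "exec W c1 s T1 s' \<Longrightarrow> exec W c2 s' T2 s'' \<Longrightarrow> exec W (Seq c1 c2) s (T1 + T2) s''"
| CondTrue: "holds b s \<Longrightarrow> exec W c1 s T s' \<Longrightarrow> exec W (Cond b c1 c2) s (1 + T) s'"
| CondFalse: "\<not> holds b s \<Longrightarrow> exec W c2 s T s' \<Longrightarrow> exec W (Cond b c1 c2) s (1 + T) s'"
| WhileFalse: "\<not> holds b s \<Longrightarrow> exec W (While b c) s 1 s"
| WhileTrue: "holds b s \<Longrightarrow> exec W c s T1 s' \<Longrightarrow> exec W (While b c) s' T2 s'' \<Longrightarrow>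
    exec W (While b c) s (1 + T1 + T2) s''"

inductive_cases exec_SkipE: "exec W Skip s T s'"
  and exec_ConstE: "exec W (Const x k) s T s'"
  and exec_MoveE: "exec W (Move x y) s T s'"
  and exec_AddE: "exec W (Add x y z) s T s'"
  and exec_SubE: "exec W (Sub x y z) s T s'"
  and exec_LoadE: "exec W (Load x a i) s T s'"
  and exec_StoreE: "exec W (Store a i x) s T s'"
  and exec_SeqE: "exec W (Seq c1 c2) s T s'"
  and exec_CondE: "exec W (Cond b c1 c2) s T s'"
  and exec_WhileE: "exec W (While b c) s T s'"

lemma exec_deterministic:
  "exec W c s T s' \<Longrightarrow> exec W c s T' s'' \<Longrightarrow> T' = T \<and> s'' = s'"
proof (induction arbitrary: T' s'' rule: exec.induct)
  case (Seq c1 s T1 s' c2 T2 r)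
  from Seq.prems obtain T1' r' T2' where
    "T' = T1' + T2'" and 1: "exec W c1 s T1' r'" and 2: "exec W c2 r' T2' s''"
    by (rule exec_SeqE)
  with Seq.IH(1)[OF 1] Seq.IH(2) show ?case by simp
next
  case (CondTrue b s c1 T s' c2)
  from CondTrue.prems show ?case
    by (rule exec_CondE) (simp_all add: CondTrue.IH CondTrue.hyps)
next
  case (CondFalse b s c2 T s' c1)
  from CondFalse.prems show ?case
    by (rule exec_CondE) (simp_all add: CondFalse.IH CondFalse.hyps)
next
  case (WhileFalse b s c)
  from WhileFalse.prems show ?case
    by (rule exec_WhileE) (simp_all add: WhileFalse.hyps)
next
  case (WhileTrue b s c T1 s' T2 r)
  from WhileTrue.prems WhileTrue.hyps(1) obtain T1' r' T2' where
    "T' = 1 + T1' + T2'" and 1: "exec W c s T1' r'" and 2: "exec W (While b c) r' T2' s''"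
    by (cases rule: exec.cases) simp_all
  with WhileTrue.IH(1)[OF 1] WhileTrue.IH(2) show ?case by simp
qed (erule exec_SkipE exec_ConstE exec_MoveE exec_AddE exec_SubE exec_LoadE exec_StoreE, simp)+


section \<open>Input, output and running time\<close>

definition adjacency_lists :: "nat ugraph \<Rightarrow> nat list list \<Rightarrow> bool" where
  "adjacency_lists G L \<longleftrightarrow>
     verts G = {..<length L} \<and>
     (\<forall>v<length L. distinct (L ! v) \<and> set (L ! v) = {w. {v, w} \<in> edges G})"

definition array_of :: "nat list \<Rightarrow> nat \<Rightarrow> nat" where
  "array_of xs i = (if i < length xs then xs ! i else 0)"

text \<open>
  Register 0 holds the number of vertices.  Array 1 is the concatenation of the adjacency lists,
  the list of vertex \<open>v\<close> occupying the positions from \<open>a[v]\<close> to \<open>a[v + 1] - 1\<close> for the array \<open>a\<close>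
  with number 0.  Arrays 2 and 3 are the characteristic vectors of the two token sets.  All other
  cells are 0.
\<close>

definition input_store :: "nat list list \<Rightarrow> nat set \<Rightarrow> nat set \<Rightarrow> store" where
  "input_store L A B =
     \<lparr>regs = (\<lambda>_. 0)(0 := length L),
      arrs = (\<lambda>_ _. 0)
        (0 := array_of (map (\<lambda>v. length (concat (take v L))) [0..<length L + 1]),
         1 := array_of (concat L),
         2 := (\<lambda>v. of_bool (v \<in> A)),
         3 := (\<lambda>v. of_bool (v \<in> B)))\<rparr>"

definition answers_yes :: "store \<Rightarrow> bool" where
  "answers_yes s \<longleftrightarrow> regs s 0 = 1"

definition answers_no :: "store \<Rightarrow> bool" where
  "answers_no s \<longleftrightarrow> regs s 0 = 0"

definition output_slides :: "store \<Rightarrow> (nat \<times> nat) list" where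
  "output_slides s = map (\<lambda>i. (arrs s 4 i, arrs s 5 i)) [0..<regs s 1]"

text \<open>
  On every input \<open>(G, A, B)\<close> with \<open>G\<close> in the class \<open>\<C>\<close>, whatever the order of its adjacency
  lists, the program halts within \<open>O(|V| + |E|)\<close> steps in a store related to the input by \<open>Q\<close>.
  The polynomial bound on the machine words means that they have \<open>O(log (|V| + |E|))\<close> bits;
  the added constants only matter for very small inputs, such as the empty graph.
\<close>

definition linear_time_on ::
  "(nat ugraph \<Rightarrow> bool) \<Rightarrow> com \<Rightarrow> (nat ugraph \<Rightarrow> nat set \<Rightarrow> nat set \<Rightarrow> store \<Rightarrow> bool) \<Rightarrow> bool" where
  "linear_time_on \<C> p Q \<longleftrightarrow>
     (\<exists>c d. \<forall>G L A B.
        simple_graph G \<and> \<C> G \<and> adjacency_lists G L \<and>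
        independent_set G A \<and> independent_set G B \<longrightarrow>
        (let N = card (verts G) + card (edges G)
         in \<exists>T s. exec ((N + 2) ^ d) p (input_store L A B) T s \<and> T \<le> c * (N + 1) \<and> Q G A B s))"

definition decides_TS :: "nat ugraph \<Rightarrow> nat set \<Rightarrow> nat set \<Rightarrow> store \<Rightarrow> bool" where
  "decides_TS G A B s \<longleftrightarrow> (if reconfigurable G A B then answers_yes s else answers_no s)"

definition finds_shortest_TS :: "nat ugraph \<Rightarrow> nat set \<Rightarrow> nat set \<Rightarrow> store \<Rightarrow> bool" where
  "finds_shortest_TS G A B s \<longleftrightarrow>
     (if reconfigurable G A B
      then answers_yes s \<and> shortest_reconf_seq G A B (token_sets A (output_slides s))
      else answers_no s)"

end

theory Submission imports Defs begin

text \<open>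
  Call a vertex crowded with respect to a token set \<open>S\<close> if it has two neighbours in \<open>S\<close>.  In a
  \<open>P\<^sub>4\<close>-free graph a slide does not change the set \<open>R\<close> of crowded vertices and never enters it.
  Outside \<open>R\<close>, being at distance at most two is an equivalence relation, so its classes are the
  components of \<open>G - R\<close>, and each of them contains at most one token.  Hence every token stays in
  its component, and \<open>A\<close> can be transformed into \<open>B\<close> iff \<open>A\<close> and \<open>B\<close> have the same size
  and the same crowded vertices and every token of \<open>A\<close> has a vertex of \<open>B\<close> in its component;
  it then reaches this vertex in at most two slides, whatever the other tokens do.  This needs only
  the numbers of neighbours in \<open>A\<close> and in \<open>B\<close> and no cotree.

  The number of slides is optimal already for general graphs: summing over the tokens the distance
  to \<open>B\<close>, truncated at 2, gives a potential that drops by at most 1 in each slide.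
\<close>

section \<open>Token sliding in \<open>P\<^sub>4\<close>-free graphs\<close>

definition nbhd :: "'a ugraph \<Rightarrow> 'a \<Rightarrow> 'a set" where
  "nbhd G v = {w. {v, w} \<in> edges G}"

definition crowded :: "'a ugraph \<Rightarrow> 'a set \<Rightarrow> 'a set" where
  "crowded G S = {v. \<exists>x\<in>nbhd G v \<inter> S. \<exists>y\<in>nbhd G v \<inter> S. x \<noteq> y}"

text \<open>The components of \<open>G - R\<close> without paths: a shortest connection with three
  edges would be an induced P4, so in a \<open>P4_free\<close> graph two steps reach the whole
  component.\<close>

definition near :: "'a ugraph \<Rightarrow> 'a set \<Rightarrow> 'a \<Rightarrow> 'a \<Rightarrow> bool" where
  "near G R x y \<longleftrightarrow> x \<notin> R \<and> y \<notin> R \<and>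
     (x = y \<or> y \<in> nbhd G x \<or> (\<exists>c\<in>nbhd G x. c \<notin> R \<and> y \<in> nbhd G c))"

text \<open>The invariant of the intermediate token sets, with \<open>R\<close> held fixed: one
  token per component, so that no token can block another.\<close>

definition scattered :: "'a ugraph \<Rightarrow> 'a set \<Rightarrow> 'a set \<Rightarrow> bool" where
  "scattered G R S \<longleftrightarrow> S \<subseteq> verts G - R \<and> (\<forall>x\<in>S. \<forall>y\<in>S. near G R x y \<longrightarrow> x = y)"

text \<open>A relation, because the choice of \<open>b\<close> and \<open>c\<close> depends on the
  order of the adjacency lists. In a \<open>P4_free\<close> graph, a vertex for which no
  \<open>ms\<close> exists forces the answer no.\<close>

definition plan :: "'a ugraph \<Rightarrow> 'a set \<Rightarrow> 'a set \<Rightarrow> 'a \<Rightarrow> ('a \<times> 'a) list \<Rightarrow> bool" where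
  "plan G A B v ms \<longleftrightarrow>
     (if v \<notin> A \<or> v \<in> B then ms = []
      else if nbhd G v \<inter> B \<noteq> {} then \<exists>b\<in>nbhd G v \<inter> B. ms = [(v, b)]
      else \<exists>c\<in>nbhd G v. c \<notin> crowded G A \<and> (\<exists>b\<in>nbhd G c \<inter> B. ms = [(v, c), (c, b)]))"

definition dist_to :: "'a ugraph \<Rightarrow> 'a set \<Rightarrow> 'a \<Rightarrow> nat" where
  "dist_to G B x = (if x \<in> B then 0 else if nbhd G x \<inter> B \<noteq> {} then 1 else 2)"

section \<open>Neighbourhoods and induced paths\<close>

lemma nbhd_sym: "w \<in> nbhd G v \<longleftrightarrow> v \<in> nbhd G w"
  by (simp add: nbhd_def insert_commute)

lemma nbhd_irrefl: "simple_graph G \<Longrightarrow> v \<notin> nbhd G v"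
  by (fastforce simp: simple_graph_def nbhd_def doubleton_eq_iff)

lemma nbhd_verts: "simple_graph G \<Longrightarrow> w \<in> nbhd G v \<Longrightarrow> v \<in> verts G \<and> w \<in> verts G"
  by (fastforce simp: simple_graph_def nbhd_def doubleton_eq_iff)

lemma independent_set_iff:
  "independent_set G S \<longleftrightarrow> S \<subseteq> verts G \<and> (\<forall>u\<in>S. nbhd G u \<inter> S = {})"
  by (auto simp: independent_set_def nbhd_def)

lemma slide_iff:
  "slide G S S' \<longleftrightarrow> (\<exists>u v. u \<in> S \<and> v \<notin> S \<and> v \<in> nbhd G u \<and> S' = insert v (S - {u}))"
  by (simp add: slide_def nbhd_def)

text \<open>Stated for a walk, so that callers need not know that its vertices differ: a coincidence
  is listed next to the chords.\<close>

lemma P4_freeD: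
  assumes G: "simple_graph G" "P4_free G"
    and path: "b \<in> nbhd G a" "c \<in> nbhd G b" "d \<in> nbhd G c"
  shows "a = c \<or> b = d \<or> a = d \<or> c \<in> nbhd G a \<or> d \<in> nbhd G b \<or> d \<in> nbhd G a"
proof (rule ccontr)
  assume "\<not> ?thesis"
  then have ne: "a \<noteq> c" "b \<noteq> d" "a \<noteq> d"
    and non: "c \<notin> nbhd G a" "d \<notin> nbhd G b" "d \<notin> nbhd G a" by auto
  have ne': "a \<noteq> b" "b \<noteq> c" "c \<noteq> d" using path nbhd_irrefl[OF G(1)] by auto
  define f :: "'a \<Rightarrow> nat" where
    "f x = (if x = a then 0 else if x = b then 1 else if x = c then 2 else 3)" for x
  let ?S = "{a, b, c, d}"
  have f: "f a = 0" "f b = 1" "f c = 2" "f d = 3"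
    using ne ne' by (auto simp: f_def)
  have sub: "?S \<subseteq> verts G" using nbhd_verts[OF G(1)] path by auto
  have "bij_betw f ?S {..<4}"
    unfolding bij_betw_def using f
    by (auto simp: inj_on_def lessThan_nat_numeral lessThan_Suc numeral_2_eq_2 numeral_3_eq_3)
  moreover have "{{i, Suc i} | i. Suc i < 4} = {{0, 1}, {1, 2}, {2, 3::nat}}"
    by (auto simp: numeral_eq_Suc less_Suc_eq)
  moreover have "{x, y} \<in> edges G \<longleftrightarrow> {f x, f y} \<in> {{0, 1}, {1, 2}, {2, 3}}"
    if "x \<in> ?S" "y \<in> ?S" for x y
  proof -
    have "{x, x} \<notin> edges G" for x
      using nbhd_irrefl[OF G(1), of x] by (simp add: nbhd_def)
    then show ?thesis
      using that path non f unfolding nbhd_def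
      by (elim insertE emptyE; simp add: doubleton_eq_iff insert_commute)
  qed
  ultimately have "graph_iso (induced_subgraph G ?S) (path_graph 4)"
    unfolding graph_iso_def induced_subgraph_def path_graph_def
    by (intro exI[of _ f]) simp
  with sub G(2) show False by (auto simp: P4_free_def)
qed

section \<open>Components outside a vertex set and scattered token sets\<close>

lemma near_refl: "x \<notin> R \<Longrightarrow> near G R x x"
  by (simp add: near_def)

lemma near_sym: "near G R x y \<Longrightarrow> near G R y x"
  unfolding near_def by (metis nbhd_sym)

text \<open>A two-step connection prolonged by one edge is a walk with three edges; any coincidence
  or chord from \<open>P4_freeD\<close> shortens it to at most two, using no new vertex.\<close>

lemma near_nbhd:
  assumes "simple_graph G" "P4_free G" "near G R x y" "z \<in> nbhd G y" "z \<notin> R"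
  shows "near G R x z"
  using assms(3-5) P4_freeD[OF assms(1,2)] nbhd_sym[of _ G] unfolding near_def by metis

lemma scattered_independent:
  assumes "simple_graph G" "scattered G R S"
  shows "independent_set G S"
  using assms nbhd_irrefl[OF assms(1)]
  unfolding scattered_def independent_set_iff near_def by blast

text \<open>A token has no neighbour in \<open>S\<close>, so it is not crowded. Two distinct tokens
  joined by two edges make the middle vertex crowded, which \<open>near\<close> excludes.\<close>

lemma independent_scattered:
  assumes "simple_graph G" "independent_set G S"
  shows "scattered G (crowded G S) S"
  using assms(2) nbhd_sym[of _ G]
  unfolding scattered_def independent_set_iff near_def crowded_def by blast

text \<open>The token stays in its component, where it was the only one, so the positions of the
  other tokens are immaterial.\<close>

lemma scattered_slide:
  assumes G: "simple_graph G" "P4_free G"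
    and S: "scattered G R S" "u \<in> S" and v: "v \<in> nbhd G u" "v \<notin> R"
  shows "scattered G R (insert v (S - {u}))" and "slide G S (insert v (S - {u}))"
proof -
  have un: "u \<notin> R" using S by (auto simp: scattered_def)
  \<comment> \<open>A token near the target \<open>v\<close> is near \<open>u\<close> as well, hence
    it is \<open>u\<close> itself. This also shows that \<open>v\<close> is unoccupied.\<close>
  have *: "z = u" if "z \<in> S" "near G R z v" for z
    using near_nbhd[OF G that(2), of u] v S that un nbhd_sym[of u G v]
    unfolding scattered_def by blast
  show "scattered G R (insert v (S - {u}))"
    using S v * near_sym[of G R] nbhd_verts[OF G(1) v(1)] unfolding scattered_def by blast
  have "v \<notin> S" using *[of v] near_refl[of v R G] v nbhd_irrefl[OF G(1)] by metis
  then show "slide G S (insert v (S - {u}))"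
    using S v unfolding slide_iff by blast
qed

section \<open>Invariants of slides and the necessary conditions\<close>

text \<open>Only a neighbour \<open>v\<close> of \<open>u\<close> could stop being crowded. With a
  second token \<open>a\<close> next to \<open>v\<close>, the path \<open>w\<close>,
  \<open>u\<close>, \<open>v\<close>, \<open>a\<close> needs a chord, and independence before and
  after the slide leaves only the edge between \<open>w\<close> and \<open>v\<close>.\<close>

lemma crowded_subset_slide:
  assumes G: "simple_graph G" "P4_free G"
    and S: "independent_set G S" "independent_set G (insert w (S - {u}))"
    and "u \<in> S" "w \<in> nbhd G u"
  shows "crowded G S \<subseteq> crowded G (insert w (S - {u}))"
proof
  fix v assume v: "v \<in> crowded G S"
  show "v \<in> crowded G (insert w (S - {u}))"
  proof (cases "u \<in> nbhd G v")
    case False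
    then show ?thesis using v by (auto simp: crowded_def)
  next
    case True
    from v obtain a where a: "a \<in> nbhd G v" "a \<in> S" "a \<noteq> u" by (auto simp: crowded_def)
    have "w \<notin> nbhd G a" "a \<notin> nbhd G w" "a \<noteq> w" "a \<notin> nbhd G u"
      using S a \<open>u \<in> S\<close> \<open>w \<in> nbhd G u\<close> unfolding independent_set_iff by blast+
    with P4_freeD[OF G, of u w v a] a \<open>w \<in> nbhd G u\<close> True have "w \<in> nbhd G v"
      using nbhd_sym[of _ G] by metis
    with a \<open>a \<noteq> w\<close> show ?thesis by (auto simp: crowded_def)
  qed
qed

text \<open>A slide can be undone by a slide, so the inclusion holds in both directions.\<close>

lemma crowded_slide:
  assumes G: "simple_graph G" "P4_free G"
    and S: "independent_set G S" "independent_set G S'" and "slide G S S'"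
  shows "crowded G S' = crowded G S"
proof -
  from \<open>slide G S S'\<close> obtain u w where
    uw: "u \<in> S" "w \<notin> S" "w \<in> nbhd G u" "S' = insert w (S - {u})" by (auto simp: slide_iff)
  then have S_eq: "S = insert u (S' - {w})" by auto
  have "crowded G S \<subseteq> crowded G S'"
    using crowded_subset_slide[OF G S(1), of w u] uw S(2) by simp
  moreover have "crowded G S' \<subseteq> crowded G S"
    using crowded_subset_slide[OF G S(2), of u w, folded S_eq] uw(3,4) S(1) nbhd_sym[of u G w]
    by simp
  ultimately show ?thesis by blast
qed

text \<open>The third conjunct looks from \<open>B\<close> back to \<open>A\<close>, so that the
  induction changes only \<open>A\<close>; the other direction comes from
  \<open>reconf_seq_rev\<close>.\<close>

lemma reconf_seq_invariant:
  assumes G: "simple_graph G" "P4_free G" and "reconf_seq G A B Ss"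
  shows "card A = card B \<and> crowded G A = crowded G B \<and>
         (\<forall>b\<in>B. \<exists>a\<in>A. near G (crowded G A) b a)"
  using assms(3)
proof (induction Ss arbitrary: A)
  case Nil
  then show ?case by (simp add: reconf_seq_def)
next
  case (Cons S Ss)
  then have [simp]: "S = A" by (simp add: reconf_seq_def)
  have indep: "independent_set G A" using Cons.prems by (simp add: reconf_seq_def)
  show ?case
  proof (cases "Ss = []")
    case True
    then show ?thesis
      using Cons.prems independent_scattered[OF G(1) indep]
      by (fastforce simp: reconf_seq_def scattered_def intro: near_refl)
  next
    case False
    define A' where "A' = hd Ss"
    have seq: "reconf_seq G A' B Ss" and sl: "slide G A A'"
      using Cons.prems False by (auto simp: reconf_seq_def A'_def successively_Cons)
    have indep': "independent_set G A'" using seq by (auto simp: reconf_seq_def)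
    note eq = crowded_slide[OF G indep indep' sl]
    have fin: "finite A"
      using indep G(1) by (auto simp: independent_set_def simple_graph_def intro: finite_subset)
    from sl obtain u w where
      uw: "u \<in> A" "w \<notin> A" "w \<in> nbhd G u" "A' = insert w (A - {u})" by (auto simp: slide_iff)
    have u: "u \<notin> crowded G A"
      using independent_scattered[OF G(1) indep] uw by (auto simp: scattered_def)
    have "card A' = card A"
      using uw fin card_Suc_Diff1[OF fin uw(1)] by simp
    moreover have "\<exists>a\<in>A. near G (crowded G A) b a" if b: "b \<in> B" for b
    proof -
      from Cons.IH[OF seq] b eq obtain a' where a': "a' \<in> A'" "near G (crowded G A) b a'" by auto
      show ?thesis
      proof (cases "a' = w")
        \<comment> \<open>The moved token at \<open>w\<close> is traced back to \<open>u\<close>,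
          which is uncrowded and adjacent to \<open>w\<close>.\<close>
        case True
        then show ?thesis
          using near_nbhd[OF G a'(2), of u] uw u nbhd_sym[of u G w] by blast
      qed (use a' uw in blast)
    qed
    ultimately show ?thesis using Cons.IH[OF seq] eq by simp
  qed
qed

lemma reconf_seq_rev: "reconf_seq G A B Ss \<Longrightarrow> reconf_seq G B A (rev Ss)"
proof -
  have "slide G S' S" if "slide G S S'" for S S' :: "'a set"
  proof -
    from that obtain u v where "u \<in> S" "v \<notin> S" "{u, v} \<in> edges G" "S' = insert v (S - {u})"
      by (auto simp: slide_def)
    moreover from this have "S = insert u (S' - {v})" "u \<notin> S'" "v \<in> S'" by auto
    ultimately show ?thesis unfolding slide_def by (metis insert_commute)
  qed
  then show "reconf_seq G A B Ss \<Longrightarrow> reconf_seq G B A (rev Ss)"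
    by (auto simp: reconf_seq_def hd_rev last_rev elim: successively_mono)
qed

text \<open>By the invariant of the reversed sequence, every token of \<open>A\<close> has a vertex
  of \<open>B\<close> in its component, and the clauses of \<open>near\<close> become those of
  \<open>plan\<close>.\<close>

lemma plan_exists:
  assumes G: "simple_graph G" "P4_free G" and "reconf_seq G A B Ss"
  shows "\<exists>ms. plan G A B v ms"
proof (cases "v \<in> A")
  case True
  from reconf_seq_invariant[OF G reconf_seq_rev[OF assms(3)]] True
  obtain b where "b \<in> B" "near G (crowded G A) v b" by metis
  then consider "v \<in> B" | "b \<in> nbhd G v \<inter> B"
    | c where "c \<in> nbhd G v" "c \<notin> crowded G A" "b \<in> nbhd G c \<inter> B"
    by (auto simp: near_def)
  then have "\<exists>ms. plan G A B v ms" if "v \<in> A" "v \<notin> B" "nbhd G v \<inter> B = {}"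
    using that by cases (auto simp: plan_def)
  moreover have "\<exists>ms. plan G A B v ms" if "v \<in> A" "v \<notin> B" "b' \<in> nbhd G v \<inter> B" for b'
    using that by (auto simp: plan_def)
  moreover have "plan G A B v []" if "v \<in> B" using that by (simp add: plan_def)
  ultimately show ?thesis using True by blast
qed (simp add: plan_def)

section \<open>The lower bound on the number of slides\<close>

text \<open>As the potential of a token never exceeds 2, the edge matters only if \<open>w\<close>
  lies in \<open>B\<close>.\<close>

lemma dist_to_nbhd:
  assumes "w \<in> nbhd G u" shows "dist_to G B u \<le> Suc (dist_to G B w)"
  using assms by (auto simp: dist_to_def)

text \<open>Only the summand of the moved token changes, and it drops by at most one. The inequality
  is strict because a sequence has one set more than slides.\<close>

lemma reconf_seq_length_ge:
  assumes G: "simple_graph G" and "reconf_seq G A B Ss"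
  shows "(\<Sum>x\<in>A. dist_to G B x) < length Ss"
  using assms(2)
proof (induction Ss arbitrary: A)
  case Nil
  then show ?case by (simp add: reconf_seq_def)
next
  case (Cons S Ss)
  then have [simp]: "S = A" by (simp add: reconf_seq_def)
  have indep: "independent_set G A" using Cons.prems by (simp add: reconf_seq_def)
  show ?case
  proof (cases "Ss = []")
    case True
    then show ?thesis
      using Cons.prems by (auto simp: reconf_seq_def dist_to_def)
  next
    case False
    define A' where "A' = hd Ss"
    have seq: "reconf_seq G A' B Ss" and sl: "slide G A A'"
      using Cons.prems False by (auto simp: reconf_seq_def A'_def successively_Cons)
    have fin: "finite A"
      using indep G(1) by (auto simp: independent_set_def simple_graph_def intro: finite_subset)
    from sl obtain u w where
      uw: "u \<in> A" "w \<notin> A" "w \<in> nbhd G u" "A' = insert w (A - {u})" by (auto simp: slide_iff)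
    have "(\<Sum>x\<in>A. dist_to G B x) = dist_to G B u + (\<Sum>x\<in>A - {u}. dist_to G B x)"
      using fin uw by (simp add: sum.remove)
    also have "\<dots> \<le> Suc (\<Sum>x\<in>A'. dist_to G B x)"
      using dist_to_nbhd[OF uw(3), of B] fin uw by simp
    finally show ?thesis using Cons.IH[OF seq] by simp
  qed
qed

section \<open>A sequence that attains the lower bound\<close>

lemma length_token_sets: "length (token_sets A ms) = Suc (length ms)"
  by (induction A ms rule: token_sets.induct) auto

lemma reconf_seq_token_sets_Cons:
  assumes "independent_set G S" "slide G S (insert v (S - {u}))"
    and "reconf_seq G (insert v (S - {u})) B (token_sets (insert v (S - {u})) ms)"
  shows "reconf_seq G S B (token_sets S ((u, v) # ms))"
  using assms by (auto simp: reconf_seq_def successively_Cons)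

text \<open>Generalised to the middle of the process: the vertices in \<open>vs\<close> are still to
  be treated, the tokens of \<open>A\<close> on them have not moved, and all others are already in
  \<open>B\<close>. Equal cardinality makes \<open>S\<close> equal to \<open>B\<close> at the
  end.\<close>

lemma reconf_seq_plan:
  assumes G: "simple_graph G" "P4_free G" and B: "independent_set G B"
    and crowded: "crowded G A = crowded G B"
    and plan: "\<And>v. v \<in> set vs \<Longrightarrow> plan G A B v (f v)"
    and "distinct vs" "scattered G (crowded G A) S"
    and "A \<inter> set vs \<subseteq> S" "S \<subseteq> B \<union> (A \<inter> set vs)" "card S = card B"
  shows "reconf_seq G S B (token_sets S (concat (map f vs)))"
  using assms(5-)
proof (induction vs arbitrary: S)
  case Nil
  have "finite B" using B G by (auto simp: independent_set_def simple_graph_def intro: finite_subset)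
  with Nil have "S = B" by (simp add: card_subset_eq)
  with B show ?case by (simp add: reconf_seq_def)
next
  case (Cons v vs)
  let ?R = "crowded G A"
  have plan_v: "plan G A B v (f v)" using Cons.prems by simp
  have indep: "independent_set G S" by (rule scattered_independent[OF G(1) Cons.prems(3)])
  have fin: "finite S"
    using indep G(1) by (auto simp: independent_set_def simple_graph_def intro: finite_subset)
  \<comment> \<open>Vertices of \<open>B\<close> are uncrowded for \<open>B\<close>, hence for
    \<open>A\<close>, so they are admissible targets for \<open>scattered_slide\<close>.\<close>
  have BR: "b \<notin> ?R" if "b \<in> B" for b
    using independent_scattered[OF G(1) B] crowded that by (auto simp: scattered_def)
  have step: "scattered G ?R (insert y (T - {x}))" "slide G T (insert y (T - {x}))"
    "independent_set G T" "card (insert y (T - {x})) = card T"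
    if "scattered G ?R T" "x \<in> T" "y \<in> nbhd G x" "y \<notin> ?R" for T x y
  proof -
    show "scattered G ?R (insert y (T - {x}))" "slide G T (insert y (T - {x}))"
      using scattered_slide[OF G that] by auto
    show "independent_set G T" by (rule scattered_independent[OF G(1) that(1)])
    have finT: "finite T"
      using \<open>independent_set G T\<close> G(1)
      by (auto simp: independent_set_def simple_graph_def intro: finite_subset)
    have "y \<notin> T"
      using \<open>independent_set G T\<close> that unfolding independent_set_iff by blast
    with finT that card_Suc_Diff1[OF finT that(2)] show "card (insert y (T - {x})) = card T"
      by simp
  qed
  consider "f v = []" "v \<notin> A \<or> v \<in> B"
    | b where "v \<in> A" "v \<notin> B" "b \<in> B" "b \<in> nbhd G v" "f v = [(v, b)]"
    | c b where "v \<in> A" "v \<notin> B" "b \<in> B" "c \<in> nbhd G v" "c \<notin> ?R" "b \<in> nbhd G c"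
        "nbhd G v \<inter> B = {}" "f v = [(v, c), (c, b)]"
    using plan_v by (auto simp: plan_def split: if_splits)
  then show ?case
  proof cases
    case 1
    then show ?thesis using Cons.IH[of S] Cons.prems by auto
  next
    case 2
    have vS: "v \<in> S" using 2 Cons.prems by auto
    note st = step[OF Cons.prems(3) vS 2(4) BR[OF 2(3)]]
    have "reconf_seq G (insert b (S - {v})) B
        (token_sets (insert b (S - {v})) (concat (map f vs)))"
      by (rule Cons.IH) (use Cons.prems st 2 in auto)
    then show ?thesis
      using reconf_seq_token_sets_Cons[OF st(3,2)] 2 by simp
  next
    case 3
    have vS: "v \<in> S" using 3 Cons.prems by auto
    note st = step[OF Cons.prems(3) vS 3(4,5)]
    let ?S = "insert c (S - {v})"
    note st2 = step[OF st(1) _ 3(6) BR[OF 3(3)], simplified]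
    \<comment> \<open>As \<open>c\<close> was free, both slides together just replace
      \<open>v\<close> by \<open>b\<close>, which restores the hypotheses for the remaining
      vertices.\<close>
    have "c \<notin> S" using indep vS 3(4) unfolding independent_set_iff by blast
    then have eq: "?S - {c} = S - {v}" by auto
    have "reconf_seq G (insert b (?S - {c})) B
        (token_sets (insert b (?S - {c})) (concat (map f vs)))"
      by (rule Cons.IH) (use Cons.prems st st2 3 eq in auto)
    then have "reconf_seq G ?S B (token_sets ?S ((c, b) # concat (map f vs)))"
      using reconf_seq_token_sets_Cons[of G ?S b c B] st2 by simp
    then show ?thesis
      using reconf_seq_token_sets_Cons[OF st(3,2), of B "(c, b) # concat (map f vs)"] 3 by simp
  qed
qed

lemma length_plan: "plan G A B v ms \<Longrightarrow> length ms = (if v \<in> A then dist_to G B v else 0)"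
  by (auto simp: plan_def dist_to_def split: if_splits)

text \<open>Each plan has as many slides as its token contributes to the potential, so the lower
  bound is attained.\<close>

lemma shortest_reconf_seq_plan:
  assumes G: "simple_graph G" "P4_free G" and AB: "independent_set G A" "independent_set G B"
    and "card A = card B" "crowded G A = crowded G B"
    and vs: "distinct vs" "set vs = verts G" and plan: "\<And>v. v \<in> verts G \<Longrightarrow> plan G A B v (f v)"
  shows "shortest_reconf_seq G A B (token_sets A (concat (map f vs)))"
proof -
  have "reconf_seq G A B (token_sets A (concat (map f vs)))"
    using AB(1) vs plan independent_scattered[OF G(1) AB(1)]
    by (intro reconf_seq_plan[OF G AB(2) assms(6) _ _ _ _ _ assms(5)])
      (auto simp: independent_set_def)
  moreover have "length (concat (map f vs)) = (\<Sum>x\<in>A. dist_to G B x)"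
  proof -
    have "length (concat (map f vs)) = (\<Sum>v\<in>verts G. length (f v))"
      using vs by (simp add: length_concat sum_list_distinct_conv_sum_set comp_def)
    also have "\<dots> = (\<Sum>v\<in>verts G. if v \<in> A then dist_to G B v else 0)"
      using length_plan[OF plan] by (simp cong: sum.cong)
    also have "\<dots> = (\<Sum>x\<in>A. dist_to G B x)"
      using AB(1) G(1)
      by (simp add: sum.inter_restrict[symmetric] independent_set_def simple_graph_def Int_absorb1)
    finally show ?thesis .
  qed
  ultimately show ?thesis
    using reconf_seq_length_ge[OF G(1)]
    by (auto simp: shortest_reconf_seq_def length_token_sets Suc_le_eq)
qed


section \<open>Running programs\<close>

text \<open>A weakest precondition for total correctness; the postcondition also receives the
  running time. Halting without exceeding the word bound is part of it.\<close>

definition run :: "nat \<Rightarrow> com \<Rightarrow> store \<Rightarrow> (nat \<Rightarrow> store \<Rightarrow> bool) \<Rightarrow> bool" where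
  "run W c s Q \<longleftrightarrow> (\<exists>T s'. exec W c s T s' \<and> Q T s')"

text \<open>With these equations the simplifier executes straight-line code symbolically; loops need
  an invariant and are left to \<open>run_for\<close>.\<close>

lemma run_simps [simp]:
  "run W Skip s Q \<longleftrightarrow> Q 1 s"
  "run W (Const x k) s Q \<longleftrightarrow> k < W \<and> Q 1 (set_reg x k s)"
  "run W (Move x y) s Q \<longleftrightarrow> Q 1 (set_reg x (regs s y) s)"
  "run W (Add x y z) s Q \<longleftrightarrow> regs s y + regs s z < W \<and> Q 1 (set_reg x (regs s y + regs s z) s)"
  "run W (Sub x y z) s Q \<longleftrightarrow> Q 1 (set_reg x (regs s y - regs s z) s)"
  "run W (Load x a i) s Q \<longleftrightarrow> Q 1 (set_reg x (arrs s a (regs s i)) s)"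
  "run W (Store a i x) s Q \<longleftrightarrow> Q 1 (set_arr a (regs s i) (regs s x) s)"
  "run W (Seq c1 c2) s Q \<longleftrightarrow> run W c1 s (\<lambda>T1 s1. run W c2 s1 (\<lambda>T2. Q (T1 + T2)))"
  "run W (Cond b c1 c2) s Q \<longleftrightarrow>
     (if holds b s then run W c1 s (\<lambda>T. Q (1 + T)) else run W c2 s (\<lambda>T. Q (1 + T)))"
proof -
  show "run W (Seq c1 c2) s Q \<longleftrightarrow> run W c1 s (\<lambda>T1 s1. run W c2 s1 (\<lambda>T2. Q (T1 + T2)))"
    unfolding run_def by (blast elim: exec_SeqE intro: exec.Seq)
  show "run W (Cond b c1 c2) s Q \<longleftrightarrow>
     (if holds b s then run W c1 s (\<lambda>T. Q (1 + T)) else run W c2 s (\<lambda>T. Q (1 + T)))"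
  proof (cases "holds b s")
    case True
    then have "exec W (Cond b c1 c2) s T s' \<longleftrightarrow> (\<exists>T'. T = 1 + T' \<and> exec W c1 s T' s')" for T s'
      using exec.CondTrue[OF True] by (auto elim!: exec_CondE)
    then show ?thesis
      unfolding run_def if_P[OF True] by auto
  next
    case False
    then have "exec W (Cond b c1 c2) s T s' \<longleftrightarrow> (\<exists>T'. T = 1 + T' \<and> exec W c2 s T' s')" for T s'
      using exec.CondFalse[OF False] by (auto elim!: exec_CondE)
    then show ?thesis
      unfolding run_def if_not_P[OF False] by auto
  qed
qed (unfold run_def, auto intro: exec.intros[unfolded One_nat_def]
      elim!: exec_SkipE exec_ConstE exec_MoveE exec_AddE exec_SubE exec_LoadE exec_StoreE)

lemma run_mono: "run W c s P \<Longrightarrow> (\<And>T s'. P T s' \<Longrightarrow> Q T s') \<Longrightarrow> run W c s Q"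
  unfolding run_def by blast

text \<open>A separate bound \<open>t k\<close> for each pass lets the degrees add up to the number
  of arcs. The invariant fixes the loop counter, which gives termination; the leading 1 is the
  failing test.\<close>

lemma run_for:
  assumes "lo \<le> hi" and "J lo s"
    and reg: "\<And>k s. J k s \<Longrightarrow> regs s i = k \<and> regs s h = hi"
    and body: "\<And>k s. lo \<le> k \<Longrightarrow> k < hi \<Longrightarrow> J k s \<Longrightarrow> run W c s (\<lambda>T s'. T \<le> t k \<and> J (Suc k) s')"
  shows "run W (While (Less i h) c) s (\<lambda>T s'. T \<le> 1 + (\<Sum>k=lo..<hi. 1 + t k) \<and> J hi s')"
  using assms(1,2) body
proof (induction "hi - lo" arbitrary: lo s)
  case 0
  then have "\<not> holds (Less i h) s" using reg[of lo s] by simp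
  then show ?case using 0 unfolding run_def by (fastforce intro: exec.WhileFalse)
next
  case (Suc d)
  then have lt: "lo < hi" by simp
  then have b: "holds (Less i h) s" using Suc.prems reg[of lo s] by simp
  from Suc.prems(3)[OF le_refl lt Suc.prems(2)] obtain T1 s1 where
    1: "exec W c s T1 s1" "T1 \<le> t lo" "J (Suc lo) s1" unfolding run_def by blast
  have "run W (While (Less i h) c) s1 (\<lambda>T s'. T \<le> 1 + (\<Sum>k=Suc lo..<hi. 1 + t k) \<and> J hi s')"
    using Suc.hyps(1)[of "Suc lo" s1] Suc.hyps(2) Suc.prems(3) lt 1(3) by simp
  then obtain T2 s2 where 2: "exec W (While (Less i h) c) s1 T2 s2"
    "T2 \<le> 1 + (\<Sum>k=Suc lo..<hi. 1 + t k)" "J hi s2" unfolding run_def by blast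
  have "exec W (While (Less i h) c) s (1 + T1 + T2) s2"
    by (rule exec.WhileTrue[OF b 1(1) 2(1)])
  moreover have "1 + T1 + T2 \<le> 1 + (\<Sum>k=lo..<hi. 1 + t k)"
    using 1(2) 2(2) lt by (simp add: sum.atLeast_Suc_lessThan)
  ultimately show ?case using 2(3) unfolding run_def by blast
qed


section \<open>The program\<close>

fun block :: "com list \<Rightarrow> com" where
  "block [] = Skip"
| "block (c # cs) = Seq c (block cs)"

text \<open>
  Besides the input, which is kept, the program uses the following cells.  Register 1 is the length
  of the output, registers 2 and 3 hold the constants 1 and 0, register 4 is the current vertex
  \<open>v\<close>, registers 5 and 6 are the current and the final position in its adjacency list, register 12
  is the answer, and registers 13 and 14 count the tokens of \<open>A\<close> and \<open>B\<close>.  Arrays 6 and 7 hold the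
  numbers of neighbours in \<open>A\<close> and in \<open>B\<close>, and array 8 a neighbour in \<open>B\<close> if there is one.
\<close>

definition count_loop :: com where
  "count_loop = While (Less 5 6) (block
     [Load 7 1 5, Load 8 2 7, Add 9 9 8, Load 8 3 7, Add 10 10 8,
      Cond (Equal 8 2) (Move 11 7) Skip, Add 5 5 2])"

definition count_phase :: com where
  "count_phase = While (Less 4 0) (block
     [block [Load 8 2 4, Add 13 13 8, Load 8 3 4, Add 14 14 8,
        Load 5 0 4, Add 6 4 2, Load 6 0 6, Const 9 0, Const 10 0],
      count_loop,
      block [Store 6 4 9, Store 7 4 10, Store 8 4 11,
        Cond (Less 2 9) (Cond (Less 2 10) Skip (Const 12 0)) (Cond (Less 2 10) (Const 12 0) Skip),
        Add 4 4 2]])"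

text \<open>The counts stored by the first phase decide in constant time whether a neighbour can be
  the middle vertex, so the lists of the neighbours are not scanned again. Register 9 is the flag,
  register 11 the vertex found.\<close>

definition search_loop :: com where
  "search_loop = While (Less 5 6) (block
     [Load 7 1 5, Load 8 6 7,
      Cond (Less 2 8) Skip
        (block [Load 8 7 7, Cond (Less 3 8) (block [Const 9 1, Move 11 7]) Skip]),
      Add 5 5 2])"

definition emit :: "nat \<Rightarrow> nat \<Rightarrow> com" where
  "emit x y = block [Store 4 1 x, Store 5 1 y, Add 1 1 2]"

definition two_slides :: com where
  "two_slides = block
     [block [Load 5 0 4, Add 6 4 2, Load 6 0 6, Const 9 0],
      search_loop,
      Cond (Equal 9 2) (block [Load 10 8 11, emit 4 11, emit 11 10]) (Const 12 0)]"

definition plan_token :: com where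
  "plan_token = block
     [block [Load 8 2 4, Load 9 3 4],
      Cond (Less 9 8)
        (block [Load 8 7 4, Cond (Less 3 8) (block [Load 10 8 4, emit 4 10]) two_slides])
        Skip]"

definition plan_phase :: com where
  "plan_phase = While (Less 4 0) (block [plan_token, Add 4 4 2])"

text \<open>The answer waits in register 12, because register 0 is the bound of both outer
  loops.\<close>

definition ts_program :: com where
  "ts_program = block
     [Const 2 1, Const 12 1, count_phase, Cond (Equal 13 14) Skip (Const 12 0),
      Const 4 0, plan_phase, Move 0 12]"

section \<open>The layout of the adjacency lists in memory\<close>

text \<open>In the word bound, \<open>2 * length L\<close> makes room for the output counter, as
  each token slides at most twice; positions, vertices and counts fit as well.\<close>

locale ts_input =
  fixes G :: "nat ugraph" and L :: "nat list list" and A B :: "nat set" and W :: nat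
  assumes simple: "simple_graph G" and adjacency: "adjacency_lists G L"
    and A: "A \<subseteq> verts G" and B: "B \<subseteq> verts G"
    and W: "2 * length L + length (concat L) + 2 < W"
begin

abbreviation n where "n \<equiv> length L"

definition off :: "nat \<Rightarrow> nat" where "off v = length (concat (take v L))"

abbreviation arcs :: "nat \<Rightarrow> nat set" where "arcs v \<equiv> {off v..<off (Suc v)}"
abbreviation target :: "nat \<Rightarrow> nat" where "target j \<equiv> concat L ! j"
abbreviation nA :: "nat \<Rightarrow> nat" where "nA v \<equiv> card (nbhd G v \<inter> A)"
abbreviation nB :: "nat \<Rightarrow> nat" where "nB v \<equiv> card (nbhd G v \<inter> B)"

lemma verts: "verts G = {..<n}"
  using adjacency by (simp add: adjacency_lists_def)

lemma less_n: "v \<in> A \<Longrightarrow> v < n" "v \<in> B \<Longrightarrow> v < n"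
  using A B verts by auto

lemma off_Suc: "v < n \<Longrightarrow> off (Suc v) = off v + length (L ! v)"
  by (simp add: off_def take_Suc_conv_app_nth)

lemma off_n: "off n = length (concat L)"
  by (simp add: off_def)

lemma off_mono: "v \<le> w \<Longrightarrow> off v \<le> off w"
proof -
  assume "v \<le> w"
  then have "take w L = take v L @ take (w - v) (drop v L)"
    by (metis le_add_diff_inverse take_add)
  then show ?thesis by (simp add: off_def)
qed

lemma off_le: "v \<le> n \<Longrightarrow> off v \<le> length (concat L)"
  using off_mono[of v n] off_n by simp

lemma target_nth: "v < n \<Longrightarrow> i < length (L ! v) \<Longrightarrow> target (off v + i) = L ! v ! i"
proof -
  assume "v < n" "i < length (L ! v)"
  then have "concat L = concat (take v L) @ L ! v @ concat (drop (Suc v) L)"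
    by (metis concat.simps(2) concat_append id_take_nth_drop)
  then show ?thesis
    using \<open>i < length (L ! v)\<close> by (simp add: off_def nth_append)
qed

text \<open>Distinct list entries make positions correspond to neighbours one to one, so sums over
  positions count neighbours.\<close>

lemma bij_target: "v < n \<Longrightarrow> bij_betw target (arcs v) (nbhd G v)"
proof -
  assume v: "v < n"
  have "bij_betw ((!) (L ! v)) {..<length (L ! v)} (nbhd G v)"
    using v adjacency by (auto simp: adjacency_lists_def nbhd_def intro!: bij_betw_nth)
  moreover have "bij_betw (\<lambda>j. j - off v) (arcs v) {..<length (L ! v)}"
    by (rule bij_betw_byWitness[where f' = "\<lambda>i. off v + i"]) (auto simp: off_Suc[OF v])
  ultimately have "bij_betw ((!) (L ! v) \<circ> (\<lambda>j. j - off v)) (arcs v) (nbhd G v)"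
    by (rule bij_betw_trans[rotated])
  moreover have "((!) (L ! v) \<circ> (\<lambda>j. j - off v)) j = target j" if "j \<in> arcs v" for j
    using that target_nth[OF v, of "j - off v"] by (auto simp: off_Suc[OF v])
  ultimately show ?thesis
    using bij_betw_cong[of "arcs v" "(!) (L ! v) \<circ> (\<lambda>j. j - off v)" target "nbhd G v"] by blast
qed

lemma target_nbhd: "v < n \<Longrightarrow> j \<in> arcs v \<Longrightarrow> target j \<in> nbhd G v"
  using bij_target bij_betwE by blast

lemma ex_arc: "v < n \<Longrightarrow> (\<exists>j\<in>arcs v. P (target j)) \<longleftrightarrow> (\<exists>w\<in>nbhd G v. P w)"
  using bij_target[of v] unfolding bij_betw_def by (metis (no_types, lifting) image_iff)

lemma nbhd_less: "w \<in> nbhd G v \<Longrightarrow> w < n"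
  using nbhd_verts[OF simple] verts by auto

lemma finite_nbhd: "finite (nbhd G v)"
  by (rule finite_subset[of _ "{..<n}"]) (auto dest: nbhd_less)

lemma count_arcs: "v < n \<Longrightarrow> (\<Sum>j\<in>arcs v. of_bool (target j \<in> S)) = card (nbhd G v \<inter> S)"
  using sum.reindex_bij_betw[OF bij_target, of v "\<lambda>w. of_bool (w \<in> S) :: nat"] finite_nbhd[of v]
  by simp

lemma crowded_iff: "v \<in> crowded G S \<longleftrightarrow> Suc 0 < card (nbhd G v \<inter> S)"
  using card_le_Suc0_iff_eq[of "nbhd G v \<inter> S"] finite_nbhd[of v]
  by (auto simp: crowded_def not_le[symmetric])

lemma crowded_less: "v \<in> crowded G S \<Longrightarrow> v < n"
  using nbhd_verts[OF simple] verts by (auto simp: crowded_def)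

lemma nB_pos: "0 < nB v \<longleftrightarrow> nbhd G v \<inter> B \<noteq> {}"
  using finite_nbhd[of v] by (simp add: card_gt_0_iff)

section \<open>The phase that counts neighbours in both token sets\<close>

text \<open>What both outer loops preserve. Entry \<open>n\<close> of array 0 is included because it
  is read as the end of the last list.\<close>

definition base :: "store \<Rightarrow> bool" where
  "base s \<longleftrightarrow> regs s 0 = n \<and> regs s 2 = 1 \<and> regs s 3 = 0 \<and>
     (\<forall>v\<le>n. arrs s 0 v = off v) \<and> (\<forall>j<length (concat L). arrs s 1 j = target j) \<and>
     arrs s 2 = (\<lambda>v. of_bool (v \<in> A)) \<and> arrs s 3 = (\<lambda>v. of_bool (v \<in> B))"

text \<open>The last clause is conditional because register 11 is not reset between vertices:
  without a neighbour in \<open>B\<close> it may hold a vertex from an earlier list.\<close>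

definition count_inv :: "nat \<Rightarrow> store \<Rightarrow> nat \<Rightarrow> store \<Rightarrow> bool" where
  "count_inv v s0 k s \<longleftrightarrow> arrs s = arrs s0 \<and>
     (\<forall>r\<in>{0, 1, 2, 3, 4, 6, 12, 13, 14}. regs s r = regs s0 r) \<and> regs s 5 = k \<and>
     regs s 9 = (\<Sum>j=off v..<k. of_bool (target j \<in> A)) \<and>
     regs s 10 = (\<Sum>j=off v..<k. of_bool (target j \<in> B)) \<and>
     ((\<exists>j\<in>{off v..<k}. target j \<in> B) \<longrightarrow>
        (\<exists>j\<in>{off v..<k}. target j \<in> B \<and> regs s 11 = target j))"

lemma run_count_loop:
  assumes "base s0" "v < n" "regs s0 5 = off v" "regs s0 6 = off (Suc v)"
    "regs s0 9 = 0" "regs s0 10 = 0"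
  shows "run W count_loop s0 (\<lambda>T s. T \<le> 1 + 21 * length (L ! v) \<and> count_inv v s0 (off (Suc v)) s)"
proof -
  have "run W count_loop s0
    (\<lambda>T s. T \<le> 1 + (\<Sum>k\<in>arcs v. 1 + 20) \<and> count_inv v s0 (off (Suc v)) s)"
    unfolding count_loop_def
  proof (rule run_for)
    show "off v \<le> off (Suc v)" by (simp add: off_mono)
    show "count_inv v s0 (off v) s0" using assms by (simp add: count_inv_def)
    show "regs s 5 = k \<and> regs s 6 = off (Suc v)" if "count_inv v s0 k s" for k s
      using that assms by (simp add: count_inv_def)
  next
    fix k s
    assume k: "off v \<le> k" "k < off (Suc v)" and inv: "count_inv v s0 k s"
    have kl: "k < length (concat L)" using off_le[of "Suc v"] assms(2) k by simp
    have le: "(\<Sum>j=off v..<k. of_bool (target j \<in> S)) \<le> k" for S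
    proof -
      have "(\<Sum>j=off v..<k. of_bool (target j \<in> S)) \<le> (\<Sum>j=off v..<k. 1::nat)"
        by (rule sum_mono) simp
      also have "\<dots> \<le> k" by simp
      finally show ?thesis .
    qed
    have eq: "arrs s0 (Suc 0) k = target k" "arrs s0 2 = (\<lambda>v. of_bool (v \<in> A))"
      "arrs s0 3 = (\<lambda>v. of_bool (v \<in> B))" "regs s0 2 = 1"
      and eq': "arrs s = arrs s0" "regs s 2 = 1" "regs s 5 = k"
      using inv assms(1) kl by (simp_all add: count_inv_def base_def)
    have ob: "of_bool p \<le> (1::nat)" for p by simp
    have bound: "(\<Sum>j=off v..<k. of_bool (target j \<in> S)) + of_bool p < W" "Suc k < W" for S p
      using le[of S] ob[of p] kl W by linarith+
    have sums: "(\<Sum>j=off v..<Suc k. of_bool (target j \<in> S)) =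
        (\<Sum>j=off v..<k. of_bool (target j \<in> S)) + of_bool (target k \<in> S)" for S
      using k by simp
    have ob1: "of_bool p = Suc 0 \<longleftrightarrow> p" for p by simp
    have ex_set: "(\<exists>j\<in>{off v..<Suc k}. P j) \<longleftrightarrow> P k \<or> (\<exists>j\<in>{off v..<k}. P j)" for P
      using k by (auto simp: less_Suc_eq)
    show "run W (block
       [Load 7 1 5, Load 8 2 7, Add 9 9 8, Load 8 3 7, Add 10 10 8,
        Cond (Equal 8 2) (Move 11 7) Skip, Add 5 5 2]) s (\<lambda>T s'. T \<le> 20 \<and> count_inv v s0 (Suc k) s')"
      using inv
      by (simp add: eq eq' set_reg_def count_inv_def bound sums
          ex_set ob1 del: sum.op_ivl_Suc sum_of_bool_eq split del: split_of_bool)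
  qed
  then show ?thesis by (rule run_mono) (simp add: off_Suc[OF assms(2)])
qed

definition counted :: "nat \<Rightarrow> store \<Rightarrow> bool" where
  "counted v s \<longleftrightarrow> arrs s 6 v = nA v \<and> arrs s 7 v = nB v \<and>
     (nbhd G v \<inter> B \<noteq> {} \<longrightarrow> arrs s 8 v \<in> nbhd G v \<inter> B)"

text \<open>Register 12 compares the two crowded sets vertex by vertex, since a vertex is crowded
  when its count exceeds one.\<close>

definition count_phase_inv :: "nat \<Rightarrow> store \<Rightarrow> bool" where
  "count_phase_inv k s \<longleftrightarrow> base s \<and> regs s 4 = k \<and> regs s 1 = 0 \<and>
     regs s 13 = card (A \<inter> {..<k}) \<and> regs s 14 = card (B \<inter> {..<k}) \<and>
     (\<forall>v<k. counted v s) \<and>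
     regs s 12 = of_bool (\<forall>v<k. Suc 0 < nA v \<longleftrightarrow> Suc 0 < nB v)"

lemma sum_length: "(\<Sum>k=0..<n. length (L ! k)) = length (concat L)"
  by (simp add: length_concat sum_list_sum_nth)

lemma card_Int_lessThan_Suc:
  "card (S \<inter> {..<Suc k}) = card (S \<inter> {..<k}) + of_bool (k \<in> S)" for S :: "nat set"
proof (cases "k \<in> S")
  case True
  then have "S \<inter> {..<Suc k} = insert k (S \<inter> {..<k})" by auto
  then show ?thesis using True by simp
next
  case False
  then have "S \<inter> {..<Suc k} = S \<inter> {..<k}" by (auto simp: less_Suc_eq)
  then show ?thesis using False by simp
qed

lemma card_Int_lessThan_le: "card (S \<inter> {..<k}) \<le> k" for S :: "nat set"
  using card_mono[of "{..<k}" "S \<inter> {..<k}"] by simp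

lemma run_count_phase:
  assumes "count_phase_inv 0 s"
  shows "run W count_phase s
    (\<lambda>T s'. T \<le> 1 + 61 * n + 21 * length (concat L) \<and> count_phase_inv n s')"
proof -
  \<comment> \<open>The pass for vertex \<open>k\<close> costs a constant plus a multiple of its
    degree; the constants are generous.\<close>
  have "run W count_phase s
    (\<lambda>T s'. T \<le> 1 + (\<Sum>k=0..<n. 1 + (60 + 21 * length (L ! k))) \<and> count_phase_inv n s')"
    unfolding count_phase_def
  proof (rule run_for)
    show "regs s 4 = k \<and> regs s 0 = n" if "count_phase_inv k s" for k s
      using that by (simp add: count_phase_inv_def base_def)
  next
    fix k s
    assume k: "k < n" and inv: "count_phase_inv k s"
    have b: "base s" using inv by (simp add: count_phase_inv_def)
    have eq: "arrs s 0 k = off k" "arrs s 0 (Suc k) = off (Suc k)"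
      "arrs s 2 = (\<lambda>v. of_bool (v \<in> A))" "arrs s 3 = (\<lambda>v. of_bool (v \<in> B))"
      "regs s 2 = 1" "regs s 4 = k"
      using inv k by (simp_all add: count_phase_inv_def base_def)
    have ob: "of_bool p \<le> (1::nat)" for p by simp
    have bound: "card (A \<inter> {..<k}) + of_bool p < W" "card (B \<inter> {..<k}) + of_bool p < W"
      "Suc k < W" for p
      using card_Int_lessThan_le[of A k] card_Int_lessThan_le[of B k] ob[of p] W k by linarith+
    define s1 where "s1 = s\<lparr>regs := (regs s)(8 := of_bool (k \<in> B),
      13 := card (A \<inter> {..<Suc k}), 14 := card (B \<inter> {..<Suc k}),
      5 := off k, 6 := off (Suc k), 9 := 0, 10 := 0)\<rparr>"
    have init: "run W (block [Load 8 2 4, Add 13 13 8, Load 8 3 4, Add 14 14 8,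
        Load 5 0 4, Add 6 4 2, Load 6 0 6, Const 9 0, Const 10 0]) s (\<lambda>T s'. T \<le> 10 \<and> s' = s1)"
      using inv W
      by (simp add: eq set_reg_def bound s1_def count_phase_inv_def card_Int_lessThan_Suc
          fun_upd_twist split del: split_of_bool)
    have loop: "run W count_loop s1
      (\<lambda>T s'. T \<le> 1 + 21 * length (L ! k) \<and> count_inv k s1 (off (Suc k)) s')"
      using b k by (intro run_count_loop) (simp_all add: s1_def base_def)
    have finish: "run W (block [Store 6 4 9, Store 7 4 10, Store 8 4 11,
        Cond (Less 2 9) (Cond (Less 2 10) Skip (Const 12 0)) (Cond (Less 2 10) (Const 12 0) Skip),
        Add 4 4 2]) s2 (\<lambda>T s'. T \<le> 10 \<and> count_phase_inv (Suc k) s')"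
      if "count_inv k s1 (off (Suc k)) s2" for s2
    proof -
      have r: "regs s2 9 = nA k" "regs s2 10 = nB k" "regs s2 0 = n" "regs s2 (Suc 0) = 0"
        "regs s2 2 = 1" "regs s2 3 = 0"
        "regs s2 4 = k" "regs s2 12 = regs s 12" "arrs s2 = arrs s"
        "regs s2 13 = card (A \<inter> {..<Suc k})" "regs s2 14 = card (B \<inter> {..<Suc k})"
        using that b inv count_arcs[OF k]
        by (simp_all add: count_inv_def s1_def base_def count_phase_inv_def split del: split_of_bool)
      have nb: "regs s2 11 \<in> nbhd G k \<inter> B" if "nbhd G k \<inter> B \<noteq> {}"
      proof -
        have "\<exists>j\<in>arcs k. target j \<in> B"
          using that ex_arc[OF k, of "\<lambda>w. w \<in> B"] by blast
        then obtain j where "j \<in> arcs k" "target j \<in> B" "regs s2 11 = target j"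
          using \<open>count_inv k s1 (off (Suc k)) s2\<close> unfolding count_inv_def by blast
        then show ?thesis using target_nbhd[OF k] by simp
      qed
      show ?thesis
        using inv b nb bound(3)
        by (simp add: r set_reg_def set_arr_def count_phase_inv_def base_def counted_def less_Suc_eq
            all_conj_distrib)
    qed
    show "run W (block
     [block [Load 8 2 4, Add 13 13 8, Load 8 3 4, Add 14 14 8,
        Load 5 0 4, Add 6 4 2, Load 6 0 6, Const 9 0, Const 10 0],
      count_loop,
      block [Store 6 4 9, Store 7 4 10, Store 8 4 11,
        Cond (Less 2 9) (Cond (Less 2 10) Skip (Const 12 0)) (Cond (Less 2 10) (Const 12 0) Skip),
        Add 4 4 2]]) s (\<lambda>T s'. T \<le> 60 + 21 * length (L ! k) \<and> count_phase_inv (Suc k) s')"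
      \<comment> \<open>Only the outer sequencing is unfolded, so that \<open>init\<close>,
        \<open>loop\<close> and \<open>finish\<close> apply to the three parts as they
        stand.\<close>
      unfolding block.simps(2)[of "block _"] block.simps(2)[of count_loop] run_simps(8)[of _ "block _"]
        run_simps(8)[of _ count_loop]
      by (rule run_mono[OF init], elim conjE, hypsubst, rule run_mono[OF loop], elim conjE,
          rule run_mono[OF finish], assumption, simp)
  qed (use assms in simp_all)
  then show ?thesis by (rule run_mono) (simp add: sum.distrib sum_distrib_left[symmetric] sum_length)
qed


section \<open>The search for the middle vertex of two slides\<close>

text \<open>The condition on the middle vertex in \<open>plan\<close>. It does not mention the
  token, and the stored counts decide it.\<close>

definition good_via :: "nat \<Rightarrow> bool" where
  "good_via w \<longleftrightarrow> w \<notin> crowded G A \<and> nbhd G w \<inter> B \<noteq> {}"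

definition search_inv :: "nat \<Rightarrow> store \<Rightarrow> nat \<Rightarrow> store \<Rightarrow> bool" where
  "search_inv v s0 k s \<longleftrightarrow> arrs s = arrs s0 \<and>
     (\<forall>r\<in>{0, 1, 2, 3, 4, 6, 12}. regs s r = regs s0 r) \<and> regs s 5 = k \<and>
     (if \<exists>j\<in>{off v..<k}. good_via (target j)
      then regs s 9 = 1 \<and> (\<exists>j\<in>{off v..<k}. regs s 11 = target j \<and> good_via (target j))
      else regs s 9 = 0)"

lemma run_search_loop:
  assumes "base s0" "\<forall>w<n. counted w s0" "v < n"
    "regs s0 5 = off v" "regs s0 6 = off (Suc v)" "regs s0 9 = 0"
  shows "run W search_loop s0 (\<lambda>T s. T \<le> 1 + 21 * length (L ! v) \<and> search_inv v s0 (off (Suc v)) s)"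
proof -
  have "run W search_loop s0
    (\<lambda>T s. T \<le> 1 + (\<Sum>k\<in>arcs v. 1 + 20) \<and> search_inv v s0 (off (Suc v)) s)"
    unfolding search_loop_def
  proof (rule run_for)
    show "off v \<le> off (Suc v)" by (simp add: off_mono)
    show "search_inv v s0 (off v) s0" using assms by (simp add: search_inv_def)
    show "regs s 5 = k \<and> regs s 6 = off (Suc v)" if "search_inv v s0 k s" for k s
      using that assms by (simp add: search_inv_def)
  next
    fix k s
    assume k: "off v \<le> k" "k < off (Suc v)" and inv: "search_inv v s0 k s"
    have kl: "k < length (concat L)" using off_le[of "Suc v"] assms(3) k by simp
    have tn: "target k < n" using target_nbhd[OF assms(3), of k] k nbhd_less by auto
    have eq: "arrs s0 (Suc 0) k = target k" "arrs s0 6 (target k) = nA (target k)"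
      "arrs s0 7 (target k) = nB (target k)" "regs s0 2 = 1" "regs s0 3 = 0"
      and eq': "arrs s = arrs s0" "regs s 2 = 1" "regs s 3 = 0" "regs s 5 = k"
      using inv assms(1,2) kl tn by (simp_all add: search_inv_def base_def counted_def)
    have gv: "good_via (target k) \<longleftrightarrow> \<not> Suc 0 < nA (target k) \<and> 0 < nB (target k)"
      by (simp add: good_via_def crowded_iff nB_pos)
    have set: "{off v..<Suc k} = insert k {off v..<k}" using k by auto
    have bound: "Suc k < W" "Suc 0 < W" using kl W by auto
    show "run W (block
       [Load 7 1 5, Load 8 6 7,
        Cond (Less 2 8) Skip
          (block [Load 8 7 7, Cond (Less 3 8) (block [Const 9 1, Move 11 7]) Skip]),
        Add 5 5 2]) s (\<lambda>T s'. T \<le> 20 \<and> search_inv v s0 (Suc k) s')"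
    proof (cases "good_via (target k)")
      case True
      then show ?thesis
        using inv bound gv by (simp add: eq eq' set_reg_def search_inv_def set)
    next
      case False
      then show ?thesis
        using inv bound gv by (auto simp: eq eq' set_reg_def search_inv_def set)
    qed
  qed
  then show ?thesis by (rule run_mono) (simp add: off_Suc[OF assms(3)])
qed

section \<open>The output of the slides of one token\<close>

lemma run_emit:
  assumes "regs s 2 = 1" "Suc (regs s 1) < W"
  shows "run W (emit x y) s (\<lambda>T s'. T = 4 \<and> regs s' = (regs s)(1 := Suc (regs s 1)) \<and>
    (\<forall>a. a \<noteq> 4 \<and> a \<noteq> 5 \<longrightarrow> arrs s' a = arrs s a) \<and>
    output_slides s' = output_slides s @ [(regs s x, regs s y)])"
  using assms by (simp add: emit_def set_reg_def set_arr_def output_slides_def)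

text \<open>Relative to the store before the vertex is treated. If there is no plan, only the zero
  in register 12 matters, and nothing is claimed about the slides.\<close>

definition planned :: "nat \<Rightarrow> store \<Rightarrow> store \<Rightarrow> bool" where
  "planned v s s' \<longleftrightarrow>
     (\<forall>r\<in>{0, 2, 3, 4}. regs s' r = regs s r) \<and> (\<forall>a. a \<noteq> 4 \<and> a \<noteq> 5 \<longrightarrow> arrs s' a = arrs s a) \<and>
     regs s' 1 \<le> regs s 1 + 2 \<and>
     (if \<exists>ms. plan G A B v ms
      then regs s' 12 = regs s 12 \<and>
        (\<exists>ms. plan G A B v ms \<and> output_slides s' = output_slides s @ ms)
      else regs s' 12 = 0)"

lemma run_two_slides:
  assumes s: "base s" "\<forall>w<n. counted w s" "regs s 4 = v" "regs s 1 + 2 < W"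
    and v: "v \<in> A" "v \<notin> B" "nbhd G v \<inter> B = {}"
  shows "run W two_slides s (\<lambda>T s'. T \<le> 20 + 21 * length (L ! v) \<and> planned v s s')"
proof -
  have vn: "v < n" using less_n v by simp
  have plan: "plan G A B v ms \<longleftrightarrow>
      (\<exists>c\<in>nbhd G v. good_via c \<and> (\<exists>b\<in>nbhd G c \<inter> B. ms = [(v, c), (c, b)]))" for ms
    using v by (auto simp: plan_def good_via_def)
  then have plan_ex: "(\<exists>ms. plan G A B v ms) \<longleftrightarrow> (\<exists>c\<in>nbhd G v. good_via c)"
    by (auto simp: good_via_def)
  define s1 where "s1 = s\<lparr>regs := (regs s)(5 := off v, 6 := off (Suc v), 9 := 0)\<rparr>"
  have init: "run W (block [Load 5 0 4, Add 6 4 2, Load 6 0 6, Const 9 0]) s (\<lambda>T s'. T \<le> 5 \<and> s' = s1)"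
    using s W vn by (simp add: set_reg_def s1_def base_def)
  have loop: "run W search_loop s1
      (\<lambda>T s'. T \<le> 1 + 21 * length (L ! v) \<and> search_inv v s1 (off (Suc v)) s')"
    using s vn by (intro run_search_loop) (simp_all add: s1_def base_def counted_def)
  have finish: "run W (block [Cond (Equal 9 2) (block [Load 10 8 11, emit 4 11, emit 11 10]) (Const 12 0)])
      s2 (\<lambda>T s'. T \<le> 14 \<and> planned v s s')"
    if inv: "search_inv v s1 (off (Suc v)) s2" for s2
  proof -
    have r: "arrs s2 = arrs s" "regs s2 0 = n" "regs s2 1 = regs s 1" "regs s2 2 = 1" "regs s2 3 = 0"
      "regs s2 4 = v" "regs s2 12 = regs s 12" "regs s 0 = n" "regs s 2 = 1" "regs s 3 = 0"
      using inv s by (simp_all add: search_inv_def s1_def base_def)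
    show ?thesis
    proof (cases "\<exists>c\<in>nbhd G v. good_via c")
      case False
      then have "regs s2 9 = 0" using inv ex_arc[OF vn, of good_via] by (simp add: search_inv_def)
      moreover have "0 < W" using s by simp
      ultimately show ?thesis
        using False plan_ex r s by (simp add: set_reg_def planned_def)
    next
      case True
      then have r9: "regs s2 9 = 1" and
        "\<exists>j\<in>arcs v. regs s2 11 = target j \<and> good_via (target j)"
        using inv ex_arc[OF vn, of good_via] by (simp_all add: search_inv_def)
      then have c: "regs s2 11 \<in> nbhd G v" "good_via (regs s2 11)"
        using target_nbhd[OF vn] by auto
      let ?c = "regs s2 11"
      \<comment> \<open>Array 8 yields the second target: \<open>good_via\<close> gives
        \<open>?c\<close> a neighbour in \<open>B\<close>, so the entry is meaningful.\<close>
      define b where "b = arrs s 8 ?c"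
      have b: "b \<in> nbhd G ?c \<inter> B"
        using c(2) s(2) nbhd_less[OF c(1)] by (auto simp: b_def counted_def good_via_def)
      define s3 where "s3 = set_reg 10 b s2"
      have out: "output_slides s3 = output_slides s"
        using r by (simp add: s3_def output_slides_def set_reg_def)
      have r3: "arrs s3 = arrs s" "regs s3 0 = n" "regs s3 1 = regs s 1" "regs s3 2 = 1"
        "regs s3 3 = 0" "regs s3 4 = v" "regs s3 12 = regs s 12" "regs s3 11 = ?c" "regs s3 10 = b"
        using r by (simp_all add: s3_def set_reg_def)
      have "run W (emit 4 11) s3 (\<lambda>T1 s4. run W (emit 11 10) s4 (\<lambda>T2 s5. T1 = 4 \<and> T2 = 4 \<and>
          regs s5 = (regs s3)(1 := Suc (Suc (regs s 1))) \<and>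
          (\<forall>a. a \<noteq> 4 \<and> a \<noteq> 5 \<longrightarrow> arrs s5 a = arrs s a) \<and>
          output_slides s5 = output_slides s @ [(v, ?c), (?c, b)]))"
        by (rule run_mono[OF run_emit], use r3 s in simp, use r3 s in simp)
          (rule run_mono[OF run_emit], use r3 s out in auto)
      then have "run W (emit 4 11) s3 (\<lambda>T1 s4. run W (emit 11 10) s4 (\<lambda>T2 s5. T1 + T2 = 8 \<and>
          planned v s s5))"
        using c b plan_ex True r r3 s by (elim run_mono) (auto simp: planned_def plan)
      then have "run W (block [Load 10 8 11, emit 4 11, emit 11 10]) s2
          (\<lambda>T s'. T \<le> 12 \<and> planned v s s')"
        using r by (auto simp: s3_def b_def elim!: run_mono)
      then show ?thesis
        using r r9 by (auto elim: run_mono)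
    qed
  qed
  show ?thesis
    unfolding two_slides_def block.simps(2)[of "block _"] block.simps(2)[of search_loop]
      run_simps(8)[of _ "block _"] run_simps(8)[of _ search_loop]
    by (rule run_mono[OF init], elim conjE, hypsubst, rule run_mono[OF loop], elim conjE,
        rule run_mono[OF finish], assumption, simp)
qed

lemma run_plan_token:
  assumes s: "base s" "\<forall>w<n. counted w s" "regs s 4 = v" "regs s 1 + 2 < W" and v: "v < n"
  shows "run W plan_token s (\<lambda>T s'. T \<le> 30 + 21 * length (L ! v) \<and> planned v s s')"
proof -
  define s1 where "s1 = s\<lparr>regs := (regs s)(8 := of_bool (v \<in> A), 9 := of_bool (v \<in> B))\<rparr>"
  have init: "run W (block [Load 8 2 4, Load 9 3 4]) s (\<lambda>T s'. T \<le> 3 \<and> s' = s1)"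
    using s by (simp add: set_reg_def s1_def base_def split del: split_of_bool)
  have "run W (block [Cond (Less 9 8)
        (block [Load 8 7 4, Cond (Less 3 8) (block [Load 10 8 4, emit 4 10]) two_slides])
        Skip]) s1 (\<lambda>T s'. T \<le> 27 + 21 * length (L ! v) \<and> planned v s s')"
  \<comment> \<open>The test of the program compares two membership bits, so it succeeds exactly for
    tokens of \<open>A\<close> outside \<open>B\<close>.\<close>
  proof (cases "v \<in> A \<and> v \<notin> B")
    case False
    then have plan: "plan G A B v = (\<lambda>ms. ms = [])" by (auto simp: plan_def)
    have "\<not> regs s1 9 < regs s1 8" using False by (auto simp: s1_def)
    then show ?thesis
      by (simp add: planned_def plan) (simp add: plan s1_def output_slides_def)
  next
    case True
    define s2 where "s2 = set_reg 8 (nB v) s1"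
    have less: "regs s1 9 < regs s1 8" using True by (simp add: s1_def)
    have load: "set_reg 8 (arrs s1 7 (regs s1 4)) s1 = s2"
      using s v by (simp add: s1_def s2_def counted_def)
    have r2: "base s2" "\<forall>w<n. counted w s2" "regs s2 4 = v" "regs s2 1 + 2 < W" "regs s2 3 = 0"
      "regs s2 8 = nB v"
      using s by (simp_all add: s2_def s1_def base_def counted_def set_reg_def)
    \<comment> \<open>The registers 8 and 9 loaded so far are not among those that
      \<open>planned\<close> speaks of.\<close>
    have planned: "planned v s s' \<longleftrightarrow> planned v s2 s'" for s'
    proof -
      have "arrs s2 = arrs s" "output_slides s2 = output_slides s" "regs s2 0 = regs s 0"
        "regs s2 1 = regs s 1" "regs s2 2 = regs s 2" "regs s2 3 = regs s 3"
        "regs s2 4 = regs s 4" "regs s2 12 = regs s 12"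
        by (simp_all add: s1_def s2_def set_reg_def output_slides_def)
      then show ?thesis by (simp only: planned_def ball_simps bex_simps)
    qed
    show ?thesis
    proof (cases "nbhd G v \<inter> B = {}")
      case N: True
      then have "\<not> 0 < nB v" by simp
      then show ?thesis
        using run_two_slides[OF r2(1-4)] True N less load r2
        by (auto simp: planned elim!: run_mono)
    next
      case N: False
      then have pos: "0 < nB v" by (simp add: nB_pos)
      define b where "b = arrs s2 8 v"
      have b: "b \<in> nbhd G v \<inter> B" using N r2(2) v by (auto simp: b_def counted_def)
      have plan: "plan G A B v ms \<longleftrightarrow> (\<exists>b\<in>nbhd G v \<inter> B. ms = [(v, b)])" for ms
        using True N by (auto simp: plan_def)
      define s3 where "s3 = set_reg 10 b s2"
      have "run W (emit 4 10) s3 (\<lambda>T s'. T = 4 \<and> planned v s2 s')"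
        by (rule run_mono[OF run_emit], use r2 in \<open>simp add: s3_def set_reg_def base_def\<close>,
            use r2 in \<open>simp add: s3_def set_reg_def\<close>)
          (use b r2 in \<open>auto simp: planned_def plan s3_def set_reg_def output_slides_def\<close>)
      then have "run W (block [Load 10 8 4, emit 4 10]) s2 (\<lambda>T s'. T \<le> 6 \<and> planned v s s')"
        using r2 by (auto simp: s3_def b_def planned elim!: run_mono)
      then show ?thesis
        using less load r2 pos by (auto elim!: run_mono)
    qed
  qed
  then show ?thesis
    unfolding plan_token_def block.simps(2)[of "block [Load 8 2 4, Load 9 3 4]"]
      run_simps(8)[of _ "block [Load 8 2 4, Load 9 3 4]"]
    by (intro run_mono[OF init]) (elim conjE, hypsubst, erule run_mono, simp)
qed

section \<open>The phase that plans all tokens\<close>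

text \<open>A failed condition, whether from the counting phase or from some token, is kept as zero
  in register 12. The bound on the output length holds in either case and prevents an
  overflow.\<close>

definition plan_phase_inv :: "nat \<Rightarrow> store \<Rightarrow> bool" where
  "plan_phase_inv k s \<longleftrightarrow> base s \<and> (\<forall>v<n. counted v s) \<and> regs s 4 = k \<and> regs s 1 \<le> 2 * k \<and>
     (if card A = card B \<and> crowded G A = crowded G B \<and> (\<forall>v<k. \<exists>ms. plan G A B v ms)
      then regs s 12 = 1 \<and>
        (\<exists>f. (\<forall>v<k. plan G A B v (f v)) \<and> output_slides s = concat (map f [0..<k]))
      else regs s 12 = 0)"

lemma run_plan_phase:
  assumes "plan_phase_inv 0 s"
  shows "run W plan_phase s
    (\<lambda>T s'. T \<le> 1 + 61 * n + 21 * length (concat L) \<and> plan_phase_inv n s')"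
proof -
  have "run W plan_phase s
    (\<lambda>T s'. T \<le> 1 + (\<Sum>k=0..<n. 1 + (60 + 21 * length (L ! k))) \<and> plan_phase_inv n s')"
    unfolding plan_phase_def
  proof (rule run_for)
    show "regs s 4 = k \<and> regs s 0 = n" if "plan_phase_inv k s" for k s
      using that by (simp add: plan_phase_inv_def base_def)
  next
    fix k s
    assume k: "k < n" and inv: "plan_phase_inv k s"
    have pre: "base s" "\<forall>w<n. counted w s" "regs s 4 = k" "regs s 1 + 2 < W"
      using inv k W by (auto simp: plan_phase_inv_def)
    have inv': "plan_phase_inv (Suc k) (set_reg 4 (Suc k) s')" if p: "planned k s s'" for s'
    proof -
      let ?s = "set_reg 4 (Suc k) s'"
      let ?ok = "\<lambda>k. card A = card B \<and> crowded G A = crowded G B \<and> (\<forall>v<k. \<exists>ms. plan G A B v ms)"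
      have "base ?s" "\<forall>v<n. counted v ?s" "regs ?s 4 = Suc k" "regs ?s 1 \<le> 2 * Suc k"
        using p inv by (simp_all add: planned_def plan_phase_inv_def base_def counted_def set_reg_def)
      moreover have "regs ?s 12 = 1 \<and>
          (\<exists>f. (\<forall>v<Suc k. plan G A B v (f v)) \<and> output_slides ?s = concat (map f [0..<Suc k]))"
        if ok: "?ok (Suc k)"
      proof -
        have "?ok k" using ok by simp
        then obtain f where f: "regs s 12 = 1" "\<forall>v<k. plan G A B v (f v)"
          "output_slides s = concat (map f [0..<k])"
          using inv unfolding plan_phase_inv_def by auto
        have "\<exists>ms. plan G A B k ms" using ok by simp
        then obtain ms where ms: "regs s' 12 = regs s 12" "plan G A B k ms"
          "output_slides s' = output_slides s @ ms"
          using p unfolding planned_def by auto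
        have "output_slides ?s = concat (map (f(k := ms)) [0..<Suc k])"
          using f ms by (simp add: output_slides_def set_reg_def)
        moreover have "\<forall>v<Suc k. plan G A B v ((f(k := ms)) v)"
          using f ms by (simp add: less_Suc_eq)
        moreover have "regs ?s 12 = 1" using f(1) ms(1) by (simp add: set_reg_def)
        ultimately show ?thesis by blast
      qed
      moreover have "regs ?s 12 = 0" if "\<not> ?ok (Suc k)"
      proof (cases "?ok k")
        case True
        with that have "\<not> (\<exists>ms. plan G A B k ms)" by (auto simp: less_Suc_eq)
        then show ?thesis using p by (simp add: planned_def set_reg_def)
      next
        case False
        \<comment> \<open>A zero stays zero: \<open>planned\<close> either keeps register 12 or
          clears it.\<close>
        then have "regs s 12 = 0" using inv by (auto simp: plan_phase_inv_def split: if_splits)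
        then show ?thesis using p by (auto simp: planned_def set_reg_def split: if_splits)
      qed
      ultimately show ?thesis unfolding plan_phase_inv_def by (simp del: upt_Suc)
    qed
    show "run W (block [plan_token, Add 4 4 2]) s
      (\<lambda>T s'. T \<le> 60 + 21 * length (L ! k) \<and> plan_phase_inv (Suc k) s')"
      unfolding block.simps(2)[of plan_token] run_simps(8)[of _ plan_token]
    proof (rule run_mono[OF run_plan_token[OF pre k]], elim conjE)
      fix T s'
      assume T: "T \<le> 30 + 21 * length (L ! k)" and p: "planned k s s'"
      have "regs s' 4 = k" "regs s' 2 = 1" using p pre by (simp_all add: planned_def base_def)
      then show "run W (block [Add 4 4 2]) s'
        (\<lambda>T2 s'. T + T2 \<le> 60 + 21 * length (L ! k) \<and> plan_phase_inv (Suc k) s')"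
        using inv'[OF p] T k W by simp
    qed
  qed (use assms in simp_all)
  then show ?thesis by (rule run_mono) (simp add: sum.distrib sum_distrib_left[symmetric] sum_length)
qed


section \<open>Correctness of the whole program\<close>

lemma count_phase_inv_input: "count_phase_inv 0 (set_reg 12 1 (set_reg 2 1 (input_store L A B)))"
proof -
  have "array_of (map (\<lambda>v. length (concat (take v L))) [0..<n + 1]) v = off v" if "v \<le> n" for v
    using that by (simp add: array_of_def off_def del: upt_Suc)
  then show ?thesis
    by (simp add: count_phase_inv_def base_def input_store_def set_reg_def array_of_def)
qed

lemma crowded_eq_iff:
  "crowded G A = crowded G B \<longleftrightarrow> (\<forall>v<n. Suc 0 < nA v \<longleftrightarrow> Suc 0 < nB v)"
proof -
  have "crowded G A = crowded G B \<longleftrightarrow> (\<forall>v<n. v \<in> crowded G A \<longleftrightarrow> v \<in> crowded G B)"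
    using crowded_less by blast
  then show ?thesis by (simp add: crowded_iff)
qed

lemma plan_phase_inv_init:
  assumes "count_phase_inv n s"
  shows "plan_phase_inv 0
    (set_reg 4 0 (if regs s 13 = regs s 14 then s else set_reg 12 0 s))"
proof -
  have "A \<inter> {..<n} = A" "B \<inter> {..<n} = B" using less_n by auto
  then show ?thesis
    using assms
    by (auto simp: count_phase_inv_def plan_phase_inv_def base_def counted_def set_reg_def
        output_slides_def crowded_eq_iff)
qed

text \<open>The conditions tested are sufficient because the plans can be concatenated, and
  necessary by \<open>reconf_seq_invariant\<close> and \<open>plan_exists\<close>.\<close>

lemma finds_shortest_plan_phase_inv:
  assumes "P4_free G" "independent_set G A" "independent_set G B" "plan_phase_inv n s"
  shows "finds_shortest_TS G A B (set_reg 0 (regs s 12) s)"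
proof -
  let ?ok = "card A = card B \<and> crowded G A = crowded G B \<and> (\<forall>v<n. \<exists>ms. plan G A B v ms)"
  have slides: "output_slides (set_reg 0 (regs s 12) s) = output_slides s"
    by (simp add: output_slides_def set_reg_def)
  show ?thesis
  proof (cases ?ok)
    case True
    then obtain f where f: "regs s 12 = 1" "\<forall>v<n. plan G A B v (f v)"
      "output_slides s = concat (map f [0..<n])"
      using assms(4) unfolding plan_phase_inv_def by auto
    have "shortest_reconf_seq G A B (token_sets A (concat (map f [0..<n])))"
      using assms True f(2) verts
      by (intro shortest_reconf_seq_plan[OF simple]) (auto simp: atLeast0LessThan)
    then show ?thesis
      using f slides
      by (auto simp: finds_shortest_TS_def reconfigurable_def shortest_reconf_seq_def
          answers_yes_def set_reg_def)
  next
    case False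
    then have "\<not> reconfigurable G A B"
      using reconf_seq_invariant[OF simple assms(1)] plan_exists[OF simple assms(1)]
      unfolding reconfigurable_def by blast
    moreover have "regs s 12 = 0" using assms(4) False unfolding plan_phase_inv_def by argo
    ultimately show ?thesis by (simp add: finds_shortest_TS_def answers_no_def set_reg_def)
  qed
qed

lemma run_ts_program:
  assumes "P4_free G" "independent_set G A" "independent_set G B"
  shows "run W ts_program (input_store L A B)
    (\<lambda>T s. T \<le> 20 + 122 * n + 42 * length (concat L) \<and> finds_shortest_TS G A B s)"
proof -
  let ?s0 = "set_reg 12 1 (set_reg 2 1 (input_store L A B))"
  have "run W count_phase ?s0 (\<lambda>T1 s1.
      run W (block [Cond (Equal 13 14) Skip (Const 12 0), Const 4 0]) s1 (\<lambda>T2 s2.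
      run W plan_phase s2 (\<lambda>T3 s3. T1 + T2 + T3 \<le> 10 + 122 * n + 42 * length (concat L) \<and>
        finds_shortest_TS G A B (set_reg 0 (regs s3 12) s3))))"
  proof (rule run_mono[OF run_count_phase[OF count_phase_inv_input]], elim conjE)
    fix T1 s1
    assume T1: "T1 \<le> 1 + 61 * n + 21 * length (concat L)" and inv: "count_phase_inv n s1"
    let ?s2 = "set_reg 4 0 (if regs s1 13 = regs s1 14 then s1 else set_reg 12 0 s1)"
    have balance: "run W (block [Cond (Equal 13 14) Skip (Const 12 0), Const 4 0]) s1
        (\<lambda>T s. T \<le> 5 \<and> s = ?s2)"
      using W by auto
    have plan: "run W plan_phase ?s2
        (\<lambda>T3 s3. T1 + T2 + T3 \<le> 10 + 122 * n + 42 * length (concat L) \<and>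
          finds_shortest_TS G A B (set_reg 0 (regs s3 12) s3))" if "T2 \<le> 5" for T2
      by (rule run_mono[OF run_plan_phase[OF plan_phase_inv_init[OF inv]]])
        (use finds_shortest_plan_phase_inv[OF assms] T1 that in auto)
    show "run W (block [Cond (Equal 13 14) Skip (Const 12 0), Const 4 0]) s1 (\<lambda>T2 s2.
      run W plan_phase s2 (\<lambda>T3 s3. T1 + T2 + T3 \<le> 10 + 122 * n + 42 * length (concat L) \<and>
        finds_shortest_TS G A B (set_reg 0 (regs s3 12) s3)))"
      by (rule run_mono[OF balance]) (use plan in blast)
  qed
  then show ?thesis
    using W unfolding ts_program_def by (auto elim!: run_mono)
qed

end

section \<open>The linear time bound\<close>

text \<open>Half of the handshake lemma: an arc is determined by its edge and one bit for its
  orientation.\<close>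

lemma length_concat_adjacency_lists:
  assumes "simple_graph G" "adjacency_lists G L"
  shows "length (concat L) \<le> 2 * card (edges G)"
proof -
  have V: "verts G = {..<length L}" using assms(2) by (simp add: adjacency_lists_def)
  have "edges G \<subseteq> Pow (verts G)" using assms(1) by (auto simp: simple_graph_def)
  then have finE: "finite (edges G)" using V by (auto intro: finite_subset)
  have finN: "finite (nbhd G v)" for v
    by (rule finite_subset[of _ "verts G"]) (auto simp: V dest: nbhd_verts[OF assms(1)])
  have "length (concat L) = (\<Sum>v<length L. length (L ! v))"
    by (simp add: length_concat sum_list_sum_nth atLeast0LessThan)
  also have "\<dots> = (\<Sum>v<length L. card (nbhd G v))"
    using assms(2) by (intro sum.cong) (auto simp: adjacency_lists_def nbhd_def distinct_card[symmetric])
  also have "\<dots> = card (SIGMA v:{..<length L}. nbhd G v)"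
    by (simp add: finN)
  also have "\<dots> \<le> card (edges G \<times> (UNIV :: bool set))"
  proof (rule card_inj_on_le)
    show "inj_on (\<lambda>(v, w). ({v, w}, v < w)) (SIGMA v:{..<length L}. nbhd G v)"
      by (auto simp: inj_on_def doubleton_eq_iff)
    show "(\<lambda>(v, w). ({v, w}, v < w)) ` (SIGMA v:{..<length L}. nbhd G v) \<subseteq> edges G \<times> UNIV"
      by (auto simp: nbhd_def)
    show "finite (edges G \<times> (UNIV :: bool set))" using finE by simp
  qed
  also have "\<dots> = 2 * card (edges G)" by (simp add: card_cartesian_product)
  finally show ?thesis .
qed

lemma linear_time_finds_shortest_TS: "linear_time_on P4_free ts_program finds_shortest_TS"
  unfolding linear_time_on_def
proof (intro exI allI impI, elim conjE)
  fix G :: "nat ugraph" and L A B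
  assume G: "simple_graph G" "P4_free G" and L: "adjacency_lists G L"
    and AB: "independent_set G A" "independent_set G B"
  let ?N = "card (verts G) + card (edges G)"
  have n: "card (verts G) = length L" using L by (simp add: adjacency_lists_def)
  have len: "2 * length L + length (concat L) \<le> 2 * ?N"
    using length_concat_adjacency_lists[OF G(1) L] n by simp
  \<comment> \<open>Exponent 2 suffices for the word bound, also when the graph is empty.\<close>
  have "2 * ?N + 2 < (?N + 2) ^ 2" by (simp add: power2_eq_square algebra_simps)
  with len have "2 * length L + length (concat L) + 2 < (?N + 2) ^ 2" by linarith
  then interpret ts_input G L A B "(?N + 2) ^ 2"
    using G L AB by unfold_locales (auto simp: independent_set_def)
  \<comment> \<open>By \<open>len\<close> the time is at most \<open>20 + 122 * ?N\<close>, so 300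
    is generous.\<close>
  have "T \<le> 300 * (?N + 1)" if "T \<le> 20 + 122 * length L + 42 * length (concat L)" for T
    using that len by (simp add: algebra_simps)
  then show "let N = ?N in \<exists>T s. exec ((N + 2) ^ 2) ts_program (input_store L A B) T s \<and>
      T \<le> 300 * (N + 1) \<and> finds_shortest_TS G A B s"
    using run_ts_program[OF G(2) AB] unfolding run_def Let_def by blast
qed

theorem theorem6:
  shows "(\<exists>p. linear_time_on P4_free p decides_TS) \<and>
         (\<exists>p. linear_time_on P4_free p finds_shortest_TS)"
proof -
  \<comment> \<open>The same program decides the problem: the claim about its slides is
    dropped.\<close>
  have "decides_TS G A B s" if "finds_shortest_TS G A B s" for G A B s
    using that by (auto simp: decides_TS_def finds_shortest_TS_def split: if_splits)
  then have "linear_time_on P4_free ts_program decides_TS"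
    using linear_time_finds_shortest_TS unfolding linear_time_on_def Let_def by meson
  then show ?thesis using linear_time_finds_shortest_TS by blast
qed

end
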